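(* For every integer $n>6$ there exist rectangular designs with $m=2$ that are balanced of type 1 and E-optimal in their class $D(v,b,r,k)$, with parameters: (i) $v=2n$, $r=n-1$, $k=2$, $b=n(n-1)$, $\lambda_1=\lambda_2=0$, $\lambda_3=1$, $m=2$, $n$; (ii) the complementary series: $v=2n$, $r=(n-1)^2$, $k=2(n-1)$, $b=n(n-1)$, $\lambda_1=\lambda_2=(n-1)(n-2)$, $\lambda_3=(n-1)(n-2)+1$, $m=2$, $n$.
   Context: A rectangular design (RD) with parameters $v=mn,b,r,k,\lambda_1,\lambda_2,\lambda_3,m,n$ has its treatments arranged in an $m\times n$ array, $b$ blocks of size $k$, replication $r$, and any two distinct treatments occur together in $\lambda_1$ blocks if in the same row, $\lambda_2$ if in the same column, $\lambda_3$ otherwise. An RD with $m=2$ is balanced of type 1 if $\lambda_1=\lambda_2=\lambda_3-1$. $D(v,b,r,k)$ denotes the class of block designs with $v$ treatments, $b$ blocks of size $k$, each treatment replicated $r$ times, no treatment repeated in a block. A design with $v\times b$ incidence matrix $N$ in this class has information matrix $C=rI_v-\frac1kNN^T$; it is E-optimal in $D(v,b,r,k)$ if it maximizes the smallest positive eigenvalue of $C$ among all connected designs in the class. *)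

theory Defs
  imports Complex_Main "Jordan_Normal_Form.Char_Poly"
begin

text \<open>
  The treatments are the numbers below \<open>v\<close>. A design is the list of its blocks, so that repeated
  blocks are allowed; a block is a set, so that no treatment is repeated within a block.
\<close>

type_synonym block_design = "nat set list"

definition replication :: "block_design \<Rightarrow> nat \<Rightarrow> nat" where
  "replication d x = card {j. j < length d \<and> x \<in> d ! j}"

definition concurrence :: "block_design \<Rightarrow> nat \<Rightarrow> nat \<Rightarrow> nat" where
  "concurrence d x y = card {j. j < length d \<and> x \<in> d ! j \<and> y \<in> d ! j}"

definition design_class :: "nat \<Rightarrow> nat \<Rightarrow> nat \<Rightarrow> nat \<Rightarrow> block_design set" where
  "design_class v b r k =
     {d. length d = b \<and>
         (\<forall>B \<in> set d. B \<subseteq> {..<v} \<and> card B = k) \<and>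
         (\<forall>x<v. replication d x = r)}"

definition complement_design :: "nat \<Rightarrow> block_design \<Rightarrow> block_design" where
  "complement_design v d = map (\<lambda>B. {..<v} - B) d"

definition same_block :: "block_design \<Rightarrow> (nat \<times> nat) set" where
  "same_block d = {(x, y). \<exists>B \<in> set d. x \<in> B \<and> y \<in> B}"

definition connected_design :: "nat \<Rightarrow> block_design \<Rightarrow> bool" where
  "connected_design v d \<longleftrightarrow> (\<forall>x<v. \<forall>y<v. (x, y) \<in> (same_block d)\<^sup>*)"

definition incidence_matrix :: "nat \<Rightarrow> block_design \<Rightarrow> real mat" where
  "incidence_matrix v d = mat v (length d) (\<lambda>(i, j). if i \<in> d ! j then 1 else 0)"

definition information_matrix :: "nat \<Rightarrow> nat \<Rightarrow> nat \<Rightarrow> block_design \<Rightarrow> real mat" where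
  "information_matrix v r k d =
     real r \<cdot>\<^sub>m 1\<^sub>m v -
     (1 / real k) \<cdot>\<^sub>m (incidence_matrix v d * transpose_mat (incidence_matrix v d))"

definition smallest_positive_eigenvalue :: "real mat \<Rightarrow> real" where
  "smallest_positive_eigenvalue A = Min {e. eigenvalue A e \<and> e > 0}"

definition E_optimal :: "nat \<Rightarrow> nat \<Rightarrow> nat \<Rightarrow> nat \<Rightarrow> block_design \<Rightarrow> bool" where
  "E_optimal v b r k d \<longleftrightarrow>
     d \<in> design_class v b r k \<and> connected_design v d \<and>
     (\<forall>d' \<in> design_class v b r k. connected_design v d' \<longrightarrow>
        smallest_positive_eigenvalue (information_matrix v r k d')
          \<le> smallest_positive_eigenvalue (information_matrix v r k d))"

text \<open>
  The arrangement \<open>a\<close> sends a treatment to its (row, column) position in the array.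
\<close>

definition rectangular_design ::
  "nat \<Rightarrow> nat \<Rightarrow> nat \<Rightarrow> nat \<Rightarrow> nat \<Rightarrow> nat \<Rightarrow> nat \<Rightarrow> nat \<Rightarrow> nat \<Rightarrow> block_design \<Rightarrow> bool" where
  "rectangular_design v b r k l1 l2 l3 m n d \<longleftrightarrow>
     v = m * n \<and> d \<in> design_class v b r k \<and>
     (\<exists>a. bij_betw a {..<v} ({..<m} \<times> {..<n}) \<and>
        (\<forall>x<v. \<forall>y<v. x \<noteq> y \<longrightarrow>
           concurrence d x y =
             (if fst (a x) = fst (a y) then l1
              else if snd (a x) = snd (a y) then l2
              else l3)))"

definition balanced_type1_RD ::
  "nat \<Rightarrow> nat \<Rightarrow> nat \<Rightarrow> nat \<Rightarrow> nat \<Rightarrow> nat \<Rightarrow> nat \<Rightarrow> nat \<Rightarrow> nat \<Rightarrow> block_design \<Rightarrow> bool" where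
  "balanced_type1_RD v b r k l1 l2 l3 m n d \<longleftrightarrow>
     rectangular_design v b r k l1 l2 l3 m n d \<and> m = 2 \<and>
     l1 = l2 \<and> int l2 = int l3 - 1"

end

theory Submission
  imports Defs "HOL-Analysis.Function_Topology"
begin

text \<open>
  The design is the crown graph: \<open>K\<^sub>n\<^sub>,\<^sub>n\<close> minus a perfect matching, with its edges as blocks.
  On vectors with coordinate sum zero its concurrence matrix \<open>NN\<^sup>T\<close> has largest eigenvalue \<open>n\<close>.
  Complementing a design changes \<open>NN\<^sup>T\<close> by a multiple of the all-ones matrix only, so
  both optimality claims reduce to one statement: for every \<open>(n - 1)\<close>-regular multigraph \<open>A\<close> on
  \<open>2 n\<close> vertices there is a nonzero vector \<open>u\<close> with coordinate sum zero and
  \<open>u\<^sup>T A u \<ge> u\<^sup>T u\<close>.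

  Suppose not. Then \<open>2 I + A'\<close>, with \<open>A'\<close> the complementary adjacency matrix, is positive definite
  and even satisfies \<open>Q(w) \<ge> (n + 2) / (2 n) (\<Sum>w)\<^sup>2\<close>. Testing small integer vectors shows that
  \<open>A\<close> is simple, has no induced \<open>2 K\<^sub>2\<close> and no \<open>K\<^sub>4\<close>, and that every triangle dominates all vertices.
  The three neighbourhoods of a triangle then cover the vertices with \<open>n - 3 \<ge> 4\<close> double
  coverings, so some two vertices of the triangle have two common neighbours, which is excluded by
  an explicit null vector on eight vertices. In a triangle-free \<open>A\<close> there are exactly two vertices
  outside the neighbourhoods of any two adjacent vertices, and counting the neighbours of such a
  vertex gives \<open>n \<le> 5\<close>.
\<close>

section \<open>Regular multigraphs of degree n - 1 on 2n vertices\<close>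

text \<open>Test vectors are lists of coefficient-point pairs so that \<open>simp\<close> can
  evaluate forms on explicit vectors; coefficients at a repeated point add up.\<close>

definition combination :: "(real \<times> 'a) list \<Rightarrow> 'a \<Rightarrow> real" where
  "combination ps x = (\<Sum>(c, p)\<leftarrow>ps. if x = p then c else 0)"

lemma sum_mult_combination:
  assumes "finite V" "snd ` set ps \<subseteq> V"
  shows "(\<Sum>x\<in>V. f x * combination ps x) = (\<Sum>(c, p)\<leftarrow>ps. c * f p)"
  using assms(2)
proof (induction ps)
  case (Cons a ps)
  obtain c p where a: "a = (c, p)" by fastforce
  have "(\<Sum>x\<in>V. f x * combination (a # ps) x)
      = (\<Sum>x\<in>V. if x = p then f x * c else 0) + (\<Sum>x\<in>V. f x * combination ps x)"
    by (subst sum.distrib[symmetric], rule sum.cong)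
      (auto simp: a combination_def algebra_simps)
  then show ?case
    using Cons assms(1) by (simp add: a)
qed (simp add: combination_def)

lemma bilinear_combination:
  assumes "finite V" "snd ` set ps \<subseteq> V"
  shows "(\<Sum>x\<in>V. \<Sum>y\<in>V. f x y * combination ps x * combination ps y)
       = (\<Sum>(c, p)\<leftarrow>ps. c * (\<Sum>(c', p')\<leftarrow>ps. c' * f p p'))"
proof -
  have "(\<Sum>x\<in>V. \<Sum>y\<in>V. f x y * combination ps x * combination ps y)
      = (\<Sum>x\<in>V. (\<Sum>y\<in>V. f x y * combination ps y) * combination ps x)"
    by (intro sum.cong refl) (simp add: sum_distrib_left algebra_simps)
  also have "\<dots> = (\<Sum>(c, p)\<leftarrow>ps. c * (\<Sum>(c', p')\<leftarrow>ps. c' * f p p'))"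
    by (simp add: sum_mult_combination[OF assms])
  finally show ?thesis .
qed

text \<open>The assumptions of an argument by contradiction: \<open>spread\<close> denies the
  existence of the vector u, and the locale turns out to be inconsistent.\<close>

locale spread_regular_multigraph =
  fixes V :: "'a set" and A :: "'a \<Rightarrow> 'a \<Rightarrow> nat" and n :: nat
  assumes fin: "finite V" and cardV: "card V = 2 * n" and n_gt: "n > 6"
    and sym: "\<And>x y. x \<in> V \<Longrightarrow> y \<in> V \<Longrightarrow> A x y = A y x"
    and diag: "\<And>x. x \<in> V \<Longrightarrow> A x x = 0"
    and regular: "\<And>x. x \<in> V \<Longrightarrow> (\<Sum>y\<in>V. A x y) = n - 1"
    and spread: "\<And>u. (\<Sum>x\<in>V. u x) = (0::real) \<Longrightarrow> \<exists>x\<in>V. u x \<noteq> 0 \<Longrightarrow>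
        (\<Sum>x\<in>V. \<Sum>y\<in>V. real (A x y) * u x * u y) < (\<Sum>x\<in>V. (u x)\<^sup>2)"
begin

text \<open>The matrix \<open>2 I + A'\<close>, where \<open>A'\<close> is the adjacency matrix of the complementary graph
  (once \<open>A\<close> is known to be simple).\<close>

definition gram :: "'a \<Rightarrow> 'a \<Rightarrow> real" where
  "gram x y = (if x = y then 2 else 1 - real (A x y))"

definition gram_form :: "(real \<times> 'a) list \<Rightarrow> real" where
  "gram_form ps = (\<Sum>(c, p)\<leftarrow>ps. c * (\<Sum>(c', p')\<leftarrow>ps. c' * gram p p'))"

lemma regular_real: "x \<in> V \<Longrightarrow> (\<Sum>y\<in>V. real (A x y)) = real n - 1"
  using regular[of x] n_gt by (simp flip: of_nat_sum add: of_nat_diff)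

text \<open>On \<open>V\<close>, \<open>gram\<close> is I - A + J with J the all-ones matrix; the
  diagonal entry 2 is 1 - 0 + 1.\<close>

lemma gram_form_eq:
  assumes "snd ` set ps \<subseteq> V"
  defines "w \<equiv> combination ps"
  shows "gram_form ps = (\<Sum>x\<in>V. (w x)\<^sup>2) - (\<Sum>x\<in>V. \<Sum>y\<in>V. real (A x y) * w x * w y)
      + (\<Sum>(c, p)\<leftarrow>ps. c)\<^sup>2"
proof -
  have g: "gram x y = (if x = y then 1 else 0) - real (A x y) + 1" if "x \<in> V" for x y
    using that by (auto simp: gram_def diag)
  have s: "(\<Sum>x\<in>V. w x) = (\<Sum>(c, p)\<leftarrow>ps. c)"
    using sum_mult_combination[OF fin assms(1), of "\<lambda>_. 1"] by (simp add: w_def)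
  have sq: "(\<Sum>x\<in>V. \<Sum>y\<in>V. (if x = y then 1 else 0) * w x * w y) = (\<Sum>x\<in>V. (w x)\<^sup>2)"
    by (rule sum.cong) (auto simp: fin power2_eq_square if_distrib if_distribR cong: if_cong)
  have "gram_form ps = (\<Sum>x\<in>V. \<Sum>y\<in>V. gram x y * w x * w y)"
    by (simp add: gram_form_def w_def bilinear_combination[OF fin assms(1)])
  also have "\<dots> = (\<Sum>x\<in>V. \<Sum>y\<in>V. (if x = y then 1 else 0) * w x * w y
      - real (A x y) * w x * w y + w x * w y)"
    by (intro sum.cong) (auto simp: g algebra_simps)
  also have "\<dots> = (\<Sum>x\<in>V. (w x)\<^sup>2) - (\<Sum>x\<in>V. \<Sum>y\<in>V. real (A x y) * w x * w y)
      + (\<Sum>x\<in>V. w x) * (\<Sum>y\<in>V. w y)"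
    by (simp add: sum.distrib sum_subtractf sq sum_product)
  finally show ?thesis by (simp add: s power2_eq_square)
qed

text \<open>For coordinate sum zero the J term drops out, and \<open>spread\<close> makes the form
  positive unless the vector vanishes. A null vector with a nonzero entry is thus a
  contradiction.\<close>

lemma gram_form_zero_sum:
  assumes "snd ` set ps \<subseteq> V" "(\<Sum>(c, p)\<leftarrow>ps. c) = 0" "gram_form ps \<le> 0" "x \<in> V"
  shows "combination ps x = 0"
proof (rule ccontr)
  assume "combination ps x \<noteq> 0"
  moreover have "(\<Sum>x\<in>V. combination ps x) = 0"
    using sum_mult_combination[OF fin assms(1), of "\<lambda>_. 1"] assms(2) by simp
  ultimately show False
    using spread[of "combination ps"] gram_form_eq[OF assms(1)] assms(2-4) by fastforce
qed

text \<open>The component of the combination along the all-ones vector is removed before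
  the hypothesis is applied.\<close>

lemma gram_form_ge:
  assumes "snd ` set ps \<subseteq> V"
  shows "(\<Sum>(c, p)\<leftarrow>ps. c)\<^sup>2 * (real n + 2) \<le> gram_form ps * (2 * real n)"
proof -
  define w where "w = combination ps"
  define s where "s = (\<Sum>(c, p)\<leftarrow>ps. c)"
  define t where "t = s / (2 * real n)"
  define u where "u = (\<lambda>x. w x - t)"
  have n0: "real n > 0" using n_gt by simp
  have cV: "real (card V) = 2 * real n" by (simp add: cardV)
  have s: "(\<Sum>x\<in>V. w x) = s"
    using sum_mult_combination[OF fin assms, of "\<lambda>_. 1"] by (simp add: w_def s_def)
  have tn: "t * (2 * real n) = s" using n0 by (simp add: t_def)
  have u0: "(\<Sum>x\<in>V. u x) = 0"
    using tn by (simp add: u_def sum_subtractf s cV algebra_simps)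
  have "(\<Sum>x\<in>V. \<Sum>y\<in>V. real (A x y) * u x * u y) \<le> (\<Sum>x\<in>V. (u x)\<^sup>2)"
  proof (cases "\<exists>x\<in>V. u x \<noteq> 0")
    case True
    then show ?thesis using spread[OF u0] by simp
  qed simp
  moreover have "(\<Sum>x\<in>V. (u x)\<^sup>2) = (\<Sum>x\<in>V. (w x)\<^sup>2) - t * s"
  proof -
    have "(\<Sum>x\<in>V. (u x)\<^sup>2) = (\<Sum>x\<in>V. (w x)\<^sup>2 - 2 * t * w x + t * t)"
      by (simp add: u_def power2_eq_square algebra_simps)
    also have "\<dots> = (\<Sum>x\<in>V. (w x)\<^sup>2) - 2 * t * s + t * (t * (2 * real n))"
      by (simp add: sum.distrib sum_subtractf cV s flip: sum_distrib_left)
    finally show ?thesis by (simp add: tn)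
  qed
  moreover have "(\<Sum>x\<in>V. \<Sum>y\<in>V. real (A x y) * u x * u y)
      = (\<Sum>x\<in>V. \<Sum>y\<in>V. real (A x y) * w x * w y) - (real n - 1) * t * s"
  proof -
    have row: "(\<Sum>x\<in>V. \<Sum>y\<in>V. real (A x y) * f x) = (real n - 1) * (\<Sum>x\<in>V. f x)" for f
      by (simp add: sum_distrib_right[symmetric] regular_real sum_distrib_left)
    have col: "(\<Sum>x\<in>V. \<Sum>y\<in>V. real (A x y) * f y) = (real n - 1) * (\<Sum>x\<in>V. f x)" for f
      by (subst sum.swap, subst row[symmetric]) (auto intro!: sum.cong simp: sym)
    have "(\<Sum>x\<in>V. \<Sum>y\<in>V. real (A x y) * u x * u y)
        = (\<Sum>x\<in>V. \<Sum>y\<in>V. real (A x y) * w x * w y - real (A x y) * (t * w x)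
            - real (A x y) * (t * w y) + real (A x y) * (t * t))"
      by (simp add: u_def algebra_simps)
    also have "\<dots> = (\<Sum>x\<in>V. \<Sum>y\<in>V. real (A x y) * w x * w y)
        - (real n - 1) * (t * s) - (real n - 1) * (t * s) + (real n - 1) * (t * (t * (2 * real n)))"
      by (simp only: sum.distrib sum_subtractf row col)
        (simp add: cV s sum_distrib_left[symmetric])
    finally show ?thesis unfolding tn by (simp add: algebra_simps)
  qed
  \<comment> \<open>What remains is the component along the all-ones vector, whose eigenvalue under
    \<open>gram\<close> is 1 - (n - 1) + 2 n = n + 2.\<close>
  ultimately have "s\<^sup>2 - (real n - 2) * t * s \<le> gram_form ps"
    using gram_form_eq[OF assms] by (simp add: w_def s_def algebra_simps)
  then have "(s\<^sup>2 - (real n - 2) * t * s) * (2 * real n) \<le> gram_form ps * (2 * real n)"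
    using n0 by (intro mult_right_mono) auto
  moreover have "(s\<^sup>2 - (real n - 2) * t * s) * (2 * real n) = s\<^sup>2 * (2 * real n) - (real n - 2) * s * (t * (2 * real n))"
    by (simp add: algebra_simps)
  ultimately show ?thesis
    by (simp only: tn) (simp add: s_def[symmetric] power2_eq_square algebra_simps)
qed

text \<open>A bound free of n: it refutes vectors whose squared nonzero sum is at least twice their
  Gram norm.\<close>

lemma gram_form_gt:
  assumes "snd ` set ps \<subseteq> V" "(\<Sum>(c, p)\<leftarrow>ps. c) \<noteq> 0"
  shows "(\<Sum>(c, p)\<leftarrow>ps. c)\<^sup>2 < 2 * gram_form ps"
proof -
  have "(\<Sum>(c, p)\<leftarrow>ps. c)\<^sup>2 * real n < (\<Sum>(c, p)\<leftarrow>ps. c)\<^sup>2 * (real n + 2)"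
    using assms(2) by (intro mult_strict_left_mono) auto
  also have "\<dots> \<le> 2 * gram_form ps * real n"
    using gram_form_ge[OF assms(1)] by (simp add: algebra_simps)
  finally show ?thesis using n_gt by simp
qed

section \<open>Forbidden configurations in the graph\<close>

lemma gram_sym: "x \<in> V \<Longrightarrow> y \<in> V \<Longrightarrow> gram x y = gram y x"
  by (auto simp: gram_def sym)

text \<open>The vector x + y has sum 2 and Gram norm 6 - 2 \<open>A x y\<close>, so 4 < 12 - 4
  \<open>A x y\<close>.\<close>

lemma A_le_1:
  assumes "x \<in> V" "y \<in> V"
  shows "A x y \<le> 1"
proof (cases "x = y")
  case False
  then show ?thesis
    using gram_form_gt[of "[(1, x), (1, y)]"] assms sym[OF assms]
    by (simp add: gram_form_def gram_def)
qed (simp add: diag assms)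

definition nbrs :: "'a \<Rightarrow> 'a set" where
  "nbrs x = {y \<in> V. A x y = 1}"

lemma nbrs_subset: "nbrs x \<subseteq> V" by (auto simp: nbrs_def)

lemma finite_nbrs [simp]: "finite (nbrs x)"
  using nbrs_subset fin by (rule finite_subset)

lemma nbrs_sym: "x \<in> V \<Longrightarrow> y \<in> nbrs x \<Longrightarrow> x \<in> nbrs y"
  by (auto simp: nbrs_def sym)

lemma nbrs_irrefl: "x \<notin> nbrs x"
  by (auto simp: nbrs_def diag)

lemma gram_nbr: "x \<in> V \<Longrightarrow> y \<in> nbrs x \<Longrightarrow> gram x y = 0"
  using nbrs_irrefl by (auto simp: gram_def nbrs_def)

lemma gram_non_nbr: "x \<in> V \<Longrightarrow> y \<in> V \<Longrightarrow> x \<noteq> y \<Longrightarrow> y \<notin> nbrs x \<Longrightarrow> gram x y = 1"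
  using A_le_1[of x y] by (auto simp: gram_def nbrs_def)

lemma gram_self: "gram x x = 2" by (simp add: gram_def)

lemma card_nbrs:
  assumes "x \<in> V"
  shows "card (nbrs x) = n - 1"
proof -
  have "(\<Sum>y\<in>V. A x y) = (\<Sum>y\<in>V. if y \<in> nbrs x then 1 else 0)"
    using A_le_1[OF assms] by (intro sum.cong) (auto simp: nbrs_def le_Suc_eq)
  also have "\<dots> = card (nbrs x)"
    using fin nbrs_subset[of x] by (simp add: sum.If_cases Int_absorb1)
  finally show ?thesis using regular[OF assms] by simp
qed

text \<open>Otherwise x + y - a - b has sum zero and Gram norm 8 - 8 = 0: the two edges contribute
  nothing and each of the four cross pairs contributes -2.\<close>

lemma no_induced_2K2:
  assumes "x \<in> V" "y \<in> nbrs x" "a \<in> V" "a \<notin> nbrs x" "a \<notin> nbrs y" "b \<in> V" "b \<notin> nbrs x" "b \<notin> nbrs y"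
  shows "b \<notin> nbrs a"
proof
  assume ab: "b \<in> nbrs a"
  have V: "y \<in> V" using assms nbrs_subset by blast
  have ne: "a \<noteq> x" "a \<noteq> y" "b \<noteq> x" "b \<noteq> y" "a \<noteq> b" "x \<noteq> y"
    using assms ab nbrs_sym nbrs_irrefl by metis+
  note 1 = assms V ab ne
  have g: "gram x y = 0" "gram a b = 0" "gram x a = 1" "gram x b = 1" "gram y a = 1" "gram y b = 1"
    using 1 by (auto intro!: gram_nbr gram_non_nbr)
  \<comment> \<open>Adds the mirrored products, conditional on membership in
    \<open>V\<close>.\<close>
  note g' = g g[THEN trans[OF gram_sym, rotated 2]]
  have "combination [(1, x), (1, y), (-1, a), (-1, b)] x = 0"
    using 1 by (intro gram_form_zero_sum) (simp_all add: gram_form_def gram_self g' split: prod.splits)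
  then show False using ne by (simp add: combination_def)
qed

text \<open>Otherwise x + y + z - m has sum 2 and Gram norm 8 - 6 = 2, against 4 < 2 * 2.\<close>

lemma triangle_dominates:
  assumes "x \<in> V" "y \<in> nbrs x" "z \<in> nbrs x" "z \<in> nbrs y" "m \<in> V"
  shows "m \<in> nbrs x \<or> m \<in> nbrs y \<or> m \<in> nbrs z"
proof (rule ccontr)
  assume m: "\<not> ?thesis"
  have V: "y \<in> V" "z \<in> V" using assms nbrs_subset by blast+
  have ne: "m \<noteq> x" "m \<noteq> y" "m \<noteq> z"
    using assms m nbrs_sym V by metis+
  note 1 = assms V ne m
  have g: "gram x y = 0" "gram x z = 0" "gram y z = 0" "gram x m = 1" "gram y m = 1" "gram z m = 1"
    using 1 by (auto intro!: gram_nbr gram_non_nbr)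
  note g' = g g[THEN trans[OF gram_sym, rotated 2]]
  show False
    using 1 gram_form_gt[of "[(1, x), (1, y), (1, z), (-1, m)]"]
    by (simp add: gram_form_def gram_self g')
qed

text \<open>On a \<open>K_4\<close> the sum of the four vertices has Gram norm 8, against 16 < 2 *
  8.\<close>

lemma no_K4:
  assumes "x \<in> V" "y \<in> nbrs x" "z \<in> nbrs x" "z \<in> nbrs y"
  shows "nbrs x \<inter> nbrs y \<inter> nbrs z = {}"
proof (rule ccontr)
  assume "\<not> ?thesis"
  then obtain m where m: "m \<in> nbrs x" "m \<in> nbrs y" "m \<in> nbrs z" by auto
  have V: "y \<in> V" "z \<in> V" "m \<in> V" using assms m nbrs_subset by blast+
  note 1 = assms V m
  have g: "gram x y = 0" "gram x z = 0" "gram y z = 0" "gram x m = 0" "gram y m = 0" "gram z m = 0"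
    using 1 by (auto intro!: gram_nbr)
  note g' = g g[THEN trans[OF gram_sym, rotated 2]]
  show False
    using 1 gram_form_gt[of "[(1, x), (1, y), (1, z), (1, m)]"]
    by (simp add: gram_form_def gram_self g')
qed

text \<open>Inclusion-exclusion; the 2 is 2 n - 2 (n - 1).\<close>

lemma card_non_nbrs:
  assumes "x \<in> V" "y \<in> V"
  shows "card (V - (nbrs x \<union> nbrs y)) = card (nbrs x \<inter> nbrs y) + 2"
proof -
  have "card (nbrs x \<union> nbrs y) + card (nbrs x \<inter> nbrs y) = 2 * (n - 1)"
    using card_Un_Int[of "nbrs x" "nbrs y"] card_nbrs assms by simp
  moreover have "card (V - (nbrs x \<union> nbrs y)) = 2 * n - card (nbrs x \<union> nbrs y)"
    using nbrs_subset cardV by (subst card_Diff_subset) auto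
  ultimately show ?thesis using n_gt by linarith
qed

text \<open>With \<open>\<epsilon>\<^sub>j = 2 gram m' m\<^sub>j - 1\<close>, the vector
  \<open>2 m' - x - z - \<Sum>\<^sub>j \<epsilon>\<^sub>j (m\<^sub>j - (x + y) / 2)\<close> has coordinate sum and
  Gram norm zero: the vectors \<open>(x + y) / 2\<close>, \<open>(x - y) / 2\<close> and \<open>m\<^sub>j - (x + y) / 2\<close> are orthonormal,
  they are orthogonal to \<open>z\<close>, and \<open>m'\<close> has inner product \<open>\<plusminus> 1/2\<close> with each.\<close>

lemma triangle_common_nbrs_le_1:
  assumes "x \<in> V" "y \<in> nbrs x" "z \<in> nbrs x" "z \<in> nbrs y"
  shows "card (nbrs x \<inter> nbrs y) \<le> 1"
proof (rule ccontr)
  assume c: "\<not> ?thesis"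
  have V: "y \<in> V" "z \<in> V" using assms nbrs_subset by blast+
  have s: "x \<in> nbrs y" "x \<in> nbrs z" "y \<in> nbrs z" using assms V nbrs_sym by blast+
  \<comment> \<open>Exactly four m_j are wanted: the squared projections of m' on the six
    orthonormal vectors and on z then add up to 6/4 + 1/2 = 2, the norm of m'.\<close>
  have "card (V - (nbrs x \<union> nbrs y)) \<ge> 4"
    using card_non_nbrs[OF assms(1) V(1)] c by simp
  then obtain T where T: "T \<subseteq> V - (nbrs x \<union> nbrs y)" "card T = 4"
    by (meson obtain_subset_with_card_n)
  then obtain m1 m2 m3 m4 where T4: "T = {m1, m2, m3, m4}"
    and d: "m1 \<noteq> m2" "m1 \<noteq> m3" "m1 \<noteq> m4" "m2 \<noteq> m3" "m2 \<noteq> m4" "m3 \<noteq> m4"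
    by (auto simp: card_Suc_eq numeral_eq_Suc)
  \<comment> \<open>By domination all of \<open>T\<close> is adjacent to z; by
    \<open>no_induced_2K2\<close> with the edge xy it is independent.\<close>
  have m: "mj \<in> V" "mj \<notin> nbrs x" "mj \<notin> nbrs y" "mj \<in> nbrs z" "mj \<noteq> x" "mj \<noteq> y" "mj \<noteq> z"
    if "mj \<in> T" for mj
    using T(1) that triangle_dominates[OF assms, of mj] assms s by auto
  have mm: "mi \<notin> nbrs mj" if "mi \<in> T" "mj \<in> T" for mi mj
    by (rule no_induced_2K2[OF assms(1,2) m(1-3)[OF that(2)] m(1-3)[OF that(1)]])
  \<comment> \<open>Of the three triangle vertices, m' is adjacent to y only.\<close>
  have "card (V - (nbrs x \<union> nbrs z)) \<noteq> 0"
    using card_non_nbrs[OF assms(1) V(2)] by simp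
  then obtain m' where m': "m' \<in> V" "m' \<notin> nbrs x" "m' \<notin> nbrs z"
    by (metis DiffE UnI1 UnI2 card.empty ex_in_conv)
  have m'y: "m' \<in> nbrs y" using triangle_dominates[OF assms m'(1)] m' by auto
  have ne: "m' \<noteq> x" "m' \<noteq> y" "m' \<noteq> z" using m' m'y assms s nbrs_irrefl by auto
  have neT: "m' \<noteq> mj" if "mj \<in> T" for mj using m'(3) m(4)[OF that] by auto
  have TV: "m1 \<in> T" "m2 \<in> T" "m3 \<in> T" "m4 \<in> T" by (auto simp: T4)
  note inV = assms(1) V m'(1) m(1)[OF TV(1)] m(1)[OF TV(2)] m(1)[OF TV(3)] m(1)[OF TV(4)]
  have g1: "gram x y = 0" "gram x z = 0" "gram y z = 0" "gram x m' = 1" "gram y m' = 0" "gram z m' = 1"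
    using assms V m' m'y ne by (auto intro!: gram_nbr gram_non_nbr)
  have g2: "gram x mj = 1" "gram y mj = 1" "gram z mj = 0" if "mj \<in> T" for mj
    using assms V m[OF that] by (auto intro!: gram_nbr gram_non_nbr)
  have g3: "gram mi mj = 1" if "mi \<in> T" "mj \<in> T" "mi \<noteq> mj" for mi mj
    by (rule gram_non_nbr[OF m(1)[OF that(1)] m(1)[OF that(2)] that(3) mm[OF that(2,1)]])
  have g4: "gram m' mj = 0 \<or> gram m' mj = 1" if "mj \<in> T" for mj
    using gram_nbr[OF m'(1), of mj] gram_non_nbr[OF m'(1), of mj] m(1) neT that by blast
  note G1 = g1 g1[THEN trans[OF gram_sym, rotated 2]]
  note G2 = g2[OF TV(1)] g2[OF TV(2)] g2[OF TV(3)] g2[OF TV(4)]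
  note G2' = G2 G2[THEN trans[OF gram_sym, rotated 2]]
  define e where "e = (\<lambda>mj. 2 * gram m' mj - 1)"
  define E where "E = e m1 + e m2 + e m3 + e m4"
  \<comment> \<open>The multiples of (x + y) / 2 add up to E / 2 at x and at y.\<close>
  let ?ps = "[(2, m'), (E / 2 - 1, x), (E / 2, y), (-1, z),
    (- e m1, m1), (- e m2, m2), (- e m3, m3), (- e m4, m4)]"
  have G4: "gram mj m' = gram m' mj" if "mj \<in> T" for mj
    using gram_sym m m'(1) that by blast
  have "combination ?ps m' = 0"
  proof (rule gram_form_zero_sum)
    show "snd ` set ?ps \<subseteq> V" using inV by simp
    show "m' \<in> V" by fact
    show "(\<Sum>(c, p)\<leftarrow>?ps. c) = 0" by (simp add: E_def)
    show "gram_form ?ps \<le> 0"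
      \<comment> \<open>Each \<open>e mj\<close> is 1 or -1; the norm vanishes in all sixteen
        cases.\<close>
      using g4[OF TV(1)] g4[OF TV(2)] g4[OF TV(3)] g4[OF TV(4)]
      by (elim disjE) (simp_all add: gram_form_def gram_self G1 G2' g3 d d[symmetric] G4 TV inV e_def E_def)
  qed
  moreover have "combination ?ps m' = 2"
    using ne neT[OF TV(1)] neT[OF TV(2)] neT[OF TV(3)] neT[OF TV(4)]
    by (simp add: combination_def)
  ultimately show False by simp
qed

text \<open>The neighbourhoods of a triangle cover \<open>V\<close> without triple overlap, so their
  pairwise intersections have total size 3 (n - 1) - 2 n = n - 3. Each has at most one element,
  hence n <= 6.\<close>

lemma triangle_free:
  assumes "x \<in> V" "y \<in> nbrs x"
  shows "nbrs x \<inter> nbrs y = {}"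
proof (rule ccontr)
  assume "\<not> ?thesis"
  then obtain z where z: "z \<in> nbrs x" "z \<in> nbrs y" by auto
  have V: "y \<in> V" "z \<in> V" using assms z nbrs_subset by blast+
  have s: "x \<in> nbrs y" "x \<in> nbrs z" "y \<in> nbrs z" using assms z V nbrs_sym by blast+
  have V_eq: "V = nbrs x \<union> nbrs y \<union> nbrs z"
    using triangle_dominates[OF assms z] nbrs_subset by blast
  have "card (nbrs x \<union> nbrs y) + card (nbrs x \<inter> nbrs y) = 2 * (n - 1)"
    using card_Un_Int[of "nbrs x" "nbrs y"] card_nbrs assms V by simp
  moreover have "card (nbrs x \<union> nbrs y) + (n - 1) =
      2 * n + card ((nbrs x \<union> nbrs y) \<inter> nbrs z)"
    using card_Un_Int[of "nbrs x \<union> nbrs y" "nbrs z"] card_nbrs[OF V(2)] cardV V_eq by simp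
  moreover have "card ((nbrs x \<union> nbrs y) \<inter> nbrs z) = card (nbrs x \<inter> nbrs z) + card (nbrs y \<inter> nbrs z)"
    unfolding Int_Un_distrib2 using no_K4[OF assms z] by (intro card_Un_disjoint) auto
  moreover have "card (nbrs x \<inter> nbrs y) \<le> 1" "card (nbrs x \<inter> nbrs z) \<le> 1" "card (nbrs y \<inter> nbrs z) \<le> 1"
    using triangle_common_nbrs_le_1 assms z V s by blast+
  ultimately show False using n_gt by linarith
qed

text \<open>A vertex m outside both neighbourhoods of an edge xy has its n - 1 neighbours split
  between those of x and those of y. Each share is at most n - 2, so neither is empty, and a
  nonempty share is at least n - 3; hence 2 (n - 3) <= n - 1.\<close>

lemma contradiction: False
proof -
  obtain x where x: "x \<in> V" using cardV n_gt by fastforce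
  have "card (nbrs x) \<noteq> 0" using card_nbrs[OF x] n_gt by simp
  then obtain y where y: "y \<in> nbrs x" by (metis card.empty ex_in_conv)
  have yV: "y \<in> V" using y nbrs_subset by blast
  have xy: "x \<in> nbrs y" using nbrs_sym x y by blast
  have "card (V - (nbrs x \<union> nbrs y)) \<noteq> 0"
    using card_non_nbrs[OF x yV] by simp
  then obtain m where m: "m \<in> V" "m \<notin> nbrs x" "m \<notin> nbrs y"
    by (metis DiffE UnI1 UnI2 card.empty ex_in_conv)
  \<comment> \<open>A neighbour of m outside both sets would form an induced \<open>2K_2\<close>
    with the edge xy.\<close>
  have split: "nbrs m = (nbrs m \<inter> nbrs x) \<union> (nbrs m \<inter> nbrs y)"
    using no_induced_2K2[OF x y m] nbrs_subset by blast
  have part: "card (nbrs m \<inter> nbrs p) = 0 \<or> card (nbrs m \<inter> nbrs p) + 3 \<ge> n"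
    "card (nbrs m \<inter> nbrs p) + 2 \<le> n"
    if p: "p \<in> V" "q \<in> nbrs p" "m \<notin> nbrs q" "m \<notin> nbrs p" for p q
  proof -
    have q: "q \<in> V" using p nbrs_subset by blast
    have qm: "q \<notin> nbrs m" using p(3) nbrs_sym[OF m(1)] by blast
    have cp: "card (nbrs p - nbrs m) + card (nbrs m \<inter> nbrs p) = n - 1"
      using card_nbrs[OF p(1)] card_Int_Diff[of "nbrs p" "nbrs m"] by (simp add: Int_commute)
    have "card (nbrs p - nbrs m) \<ge> 1"
      using p(2) qm by (metis DiffI Suc_leI One_nat_def card_gt_0_iff empty_iff finite_Diff finite_nbrs)
    then show "card (nbrs m \<inter> nbrs p) + 2 \<le> n" using cp n_gt by linarith
    show "card (nbrs m \<inter> nbrs p) = 0 \<or> card (nbrs m \<inter> nbrs p) + 3 \<ge> n"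
    proof (cases "nbrs m \<inter> nbrs p = {}")
      case False
      then obtain a where a: "a \<in> nbrs m" "a \<in> nbrs p" by auto
      have aV: "a \<in> V" using a nbrs_subset by blast
      \<comment> \<open>As a is adjacent to p, no neighbour of p is adjacent to a; only two vertices
        avoid the neighbourhoods of both m and a.\<close>
      have "nbrs p - nbrs m \<subseteq> V - (nbrs m \<union> nbrs a)"
        using triangle_free[OF p(1) a(2)] nbrs_subset by blast
      then have "card (nbrs p - nbrs m) \<le> card (V - (nbrs m \<union> nbrs a))"
        using fin by (intro card_mono) auto
      also have "\<dots> = 2"
        using card_non_nbrs[OF m(1) aV] triangle_free[OF m(1) a(1)] by simp
      finally show ?thesis using cp by linarith
    qed simp
  qed
  have "card (nbrs m) = card (nbrs m \<inter> nbrs x) + card (nbrs m \<inter> nbrs y)"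
    using triangle_free[OF x y] by (subst split, intro card_Un_disjoint) auto
  then show False
    using part[OF x y m(3) m(2)] part[OF yV xy m(2) m(3)] card_nbrs[OF m(1)] n_gt
    by linarith
qed

end

lemma regular_multigraph_zero_sum_vector:
  fixes A :: "'a \<Rightarrow> 'a \<Rightarrow> nat"
  assumes "finite V" "card V = 2 * n" "n > 6"
    and "\<And>x y. x \<in> V \<Longrightarrow> y \<in> V \<Longrightarrow> A x y = A y x"
    and "\<And>x. x \<in> V \<Longrightarrow> A x x = 0"
    and "\<And>x. x \<in> V \<Longrightarrow> (\<Sum>y\<in>V. A x y) = n - 1"
  obtains u :: "'a \<Rightarrow> real" where "(\<Sum>x\<in>V. u x) = 0" "\<exists>x\<in>V. u x \<noteq> 0"
    "(\<Sum>x\<in>V. (u x)\<^sup>2) \<le> (\<Sum>x\<in>V. \<Sum>y\<in>V. real (A x y) * u x * u y)"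
proof (rule ccontr)
  note obt = that
  assume "\<not> thesis"
  then have "(\<Sum>x\<in>V. \<Sum>y\<in>V. real (A x y) * u x * u y) < (\<Sum>x\<in>V. (u x)\<^sup>2)"
    if "(\<Sum>x\<in>V. u x) = (0::real)" "\<exists>x\<in>V. u x \<noteq> 0" for u
    using obt that by (meson not_le)
  then interpret spread_regular_multigraph V A n
    using assms by unfold_locales
  show False by (rule contradiction)
qed

section \<open>Eigenvalues from the Rayleigh quotient\<close>

text \<open>The Rayleigh quotient attains its minimum on the unit sphere of the sum-zero space. Zero
  row sums and symmetry make this space invariant, so the minimiser is an eigenvector.\<close>

lemma zero_sum_eigenfunction_le:
  fixes M :: "nat \<Rightarrow> nat \<Rightarrow> real"
  assumes sym: "\<And>x y. x < v \<Longrightarrow> y < v \<Longrightarrow> M x y = M y x"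
    and row: "\<And>x. x < v \<Longrightarrow> (\<Sum>y<v. M x y) = 0"
    and u: "(\<Sum>x<v. u x) = 0" "\<exists>x<v. u x \<noteq> 0"
      "(\<Sum>x<v. \<Sum>y<v. M x y * u x * u y) \<le> t * (\<Sum>x<v. (u x)\<^sup>2)"
  obtains \<mu> w where "\<mu> \<le> t" "(\<Sum>x<v. w x) = 0" "(\<Sum>x<v. (w x)\<^sup>2) = 1"
    "\<And>x. x < v \<Longrightarrow> (\<Sum>y<v. M x y * w y) = \<mu> * w x"
proof -
  define b where "b = (\<lambda>f g. \<Sum>x<v. \<Sum>y<v. M x y * f x * g y)"
  define sq where "sq = (\<lambda>f::nat\<Rightarrow>real. \<Sum>x<v. (f x)\<^sup>2)"
  \<comment> \<open>Coordinates from v on are pinned to 0, so the unit sphere is a closed subset of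
    a product of compact sets.\<close>
  define B where "B = (\<lambda>x. if x < v then {-1..1} else {0::real})"
  define S where "S = PiE UNIV B \<inter> ({w. (\<Sum>x<v. w x) = 0} \<inter> {w. sq w = 1})"
  have "compact (PiE UNIV B)"
    using compactin_PiE[of "\<lambda>_. euclidean" UNIV B]
    by (simp add: euclidean_product_topology B_def)
  moreover have "closed {w. (\<Sum>x<v. w x) = (0::real)}" "closed {w. sq w = 1}"
    unfolding sq_def by (intro closed_Collect_eq continuous_intros continuous_on_product_coordinates)+
  ultimately have "compact S"
    unfolding S_def by (intro compact_Int_closed closed_Int)
  have squ: "sq u > 0"
    using u(2) unfolding sq_def by (auto intro!: sum_pos2)
  have norm: "\<exists>g\<in>S. b g g * sq f = b f f" if f: "(\<Sum>x<v. f x) = 0" "sq f > 0" for f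
  proof
    define c where "c = 1 / sqrt (sq f)"
    define g where "g = (\<lambda>x. if x < v then c * f x else 0)"
    have c2: "c\<^sup>2 * sq f = 1" using f(2) by (simp add: c_def power_divide)
    have sg: "sq g = 1"
      using c2 by (simp add: sq_def g_def power_mult_distrib flip: sum_distrib_left)
    have "\<bar>g x\<bar> \<le> 1" if "x < v" for x
    proof -
      have "(g x)\<^sup>2 \<le> sq g" unfolding sq_def using that by (intro member_le_sum) auto
      then show ?thesis using sg by (simp add: abs_square_le_1)
    qed
    moreover have "(\<Sum>x<v. g x) = 0" using f(1) by (simp add: g_def flip: sum_distrib_left)
    ultimately show "g \<in> S"
      using sg by (auto simp: S_def B_def g_def abs_le_iff)
    have "b g g = c\<^sup>2 * b f f"
      by (simp add: b_def g_def sum_distrib_left power2_eq_square algebra_simps)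
    then show "b g g * sq f = b f f" using c2 by (metis mult.commute mult.assoc mult_1)
  qed
  have "continuous_on S (\<lambda>w. b w w)"
    unfolding b_def
    by (intro continuous_intros continuous_on_subset[OF continuous_on_product_coordinates]) auto
  moreover have "S \<noteq> {}" using norm[OF u(1) squ] by blast
  ultimately obtain w where w: "w \<in> S" and min: "\<And>g. g \<in> S \<Longrightarrow> b w w \<le> b g g"
    using continuous_attains_inf[OF \<open>compact S\<close>] by blast
  define \<mu> where "\<mu> = b w w"
  have w1: "(\<Sum>x<v. w x) = 0" "sq w = 1" using w by (auto simp: S_def)
  have ray: "\<mu> * sq f \<le> b f f" if f0: "(\<Sum>x<v. f x) = 0" for f
  proof (cases "sq f = 0")
    case True
    then have "\<forall>x<v. f x = 0" by (simp add: sq_def sum_nonneg_eq_0_iff)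
    then show ?thesis using True by (simp add: b_def)
  next
    case False
    then have pos: "sq f > 0" by (simp add: sq_def sum_nonneg less_le)
    then obtain g where "g \<in> S" "b g g * sq f = b f f" using norm[OF f0] by blast
    then show ?thesis using min[of g] pos by (metis \<mu>_def mult_le_cancel_right_pos)
  qed
  \<comment> \<open>The residual D has sum zero, so w + s D may be compared with w for every
    s.\<close>
  define D where "D = (\<lambda>x. (\<Sum>y<v. M x y * w y) - \<mu> * w x)"
  have col: "(\<Sum>x<v. M x y) = 0" if "y < v" for y
    using row[OF that] sym that by simp
  have D0: "(\<Sum>x<v. D x) = 0"
  proof -
    have "(\<Sum>x<v. \<Sum>y<v. M x y * w y) = 0"
      by (subst sum.swap) (simp add: col flip: sum_distrib_right)
    then show ?thesis using w1(1) by (simp add: D_def sum_subtractf flip: sum_distrib_left)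
  qed
  have bDw: "b D w - \<mu> * (\<Sum>x<v. D x * w x) = sq D"
  proof -
    have "sq D = (\<Sum>x<v. D x * (\<Sum>y<v. M x y * w y) - \<mu> * (D x * w x))"
      unfolding sq_def by (rule sum.cong) (auto simp: D_def power2_eq_square algebra_simps)
    then show ?thesis
      by (simp add: b_def sum_subtractf sum_distrib_left algebra_simps)
  qed
  have bsym: "b w D = b D w"
    unfolding b_def by (subst sum.swap) (auto intro!: sum.cong simp: sym)
  \<comment> \<open>Minimality of w. The term linear in s makes this fail for small negative s
    unless D vanishes.\<close>
  have "0 \<le> 2 * s * sq D + s\<^sup>2 * (b D D - \<mu> * sq D)" for s
  proof -
    have "(\<Sum>x<v. w x + s * D x) = 0"
      using w1 D0 by (simp add: sum.distrib flip: sum_distrib_left)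
    note ray[OF this]
    moreover have "b (\<lambda>x. w x + s * D x) (\<lambda>x. w x + s * D x) = b w w + s * b w D + s * b D w + s\<^sup>2 * b D D"
      by (simp add: b_def sum.distrib sum_distrib_left power2_eq_square algebra_simps)
    moreover have "sq (\<lambda>x. w x + s * D x) = sq w + 2 * s * (\<Sum>x<v. D x * w x) + s\<^sup>2 * sq D"
      by (simp add: sq_def sum.distrib sum_distrib_left power2_eq_square algebra_simps)
    ultimately have "\<mu> * (1 + 2 * s * (\<Sum>x<v. D x * w x) + s\<^sup>2 * sq D)
        \<le> \<mu> + 2 * s * b D w + s\<^sup>2 * b D D"
      using bsym w1 by (simp add: \<mu>_def)
    then show ?thesis unfolding bDw[symmetric] by (simp add: algebra_simps)
  qed
  note quad = this
  have "sq D = 0"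
  proof (rule ccontr)
    assume "sq D \<noteq> 0"
    then have pos: "sq D > 0" by (simp add: sq_def sum_nonneg less_le)
    define R where "R = b D D - \<mu> * sq D"
    have R: "R \<ge> 0" using ray[OF D0] by (simp add: R_def)
    \<comment> \<open>R + 1 in place of R avoids a zero denominator; the quadratic becomes s
      \<open>sq D\<close> - s^2 < 0.\<close>
    define s where "s = - sq D / (R + 1)"
    have "s < 0" using pos R by (simp add: s_def)
    have "s * (R + 1) = - sq D" using R by (simp add: s_def)
    then have "s * (s * (R + 1)) = s * (- sq D)" by simp
    then have "2 * s * sq D + s\<^sup>2 * R = s * sq D - s\<^sup>2"
      by (simp add: power2_eq_square algebra_simps)
    also have "\<dots> < 0" using \<open>s < 0\<close> pos by (smt (verit) mult_neg_pos zero_le_power2)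
    finally show False using quad[of s] by (simp add: R_def)
  qed
  then have "\<forall>x<v. D x = 0" by (simp add: sq_def sum_nonneg_eq_0_iff)
  moreover have "\<mu> \<le> t"
  proof -
    have "\<mu> * sq u \<le> t * sq u" using ray[OF u(1)] u(3) by (simp add: b_def sq_def)
    then show ?thesis using squ by simp
  qed
  ultimately show ?thesis
    using that[of \<mu> w] w1 by (simp add: D_def sq_def)
qed

section \<open>Information matrices and E-optimality\<close>

lemma concurrence_eq_filter: "concurrence d x y = length (filter (\<lambda>B. x \<in> B \<and> y \<in> B) d)"
  by (simp add: concurrence_def length_filter_conv_card)

lemma replication_eq_concurrence: "replication d x = concurrence d x x"
  by (simp add: replication_def concurrence_def)

lemma concurrence_sym: "concurrence d x y = concurrence d y x"
  by (simp add: concurrence_eq_filter conj_commute)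

lemma concurrence_eq_sum:
  "concurrence d x y = (\<Sum>j<length d. if x \<in> d ! j \<and> y \<in> d ! j then 1 else 0)"
  by (simp add: concurrence_def sum.If_cases Int_def)

lemma design_classD:
  assumes "d \<in> design_class v b r k"
  shows "length d = b" "B \<in> set d \<Longrightarrow> B \<subseteq> {..<v}" "B \<in> set d \<Longrightarrow> card B = k"
    "x < v \<Longrightarrow> concurrence d x x = r"
  using assms by (auto simp: design_class_def replication_eq_concurrence)

text \<open>Double counting: each of the r blocks through x contributes its k members.\<close>

lemma concurrence_row_sum:
  assumes "d \<in> design_class v b r k" "x < v"
  shows "(\<Sum>y<v. concurrence d x y) = r * k"
proof -
  have "(\<Sum>y<v. concurrence d x y)
      = (\<Sum>j<length d. \<Sum>y<v. if x \<in> d ! j \<and> y \<in> d ! j then 1 else 0)"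
    unfolding concurrence_eq_sum by (rule sum.swap)
  also have "\<dots> = (\<Sum>j<length d. (if x \<in> d ! j then 1 else 0) * k)"
  proof (rule sum.cong)
    fix j assume "j \<in> {..<length d}"
    then have "d ! j \<in> set d" by simp
    then have "d ! j \<subseteq> {..<v}" "card (d ! j) = k" using design_classD[OF assms(1)] by auto
    then show "(\<Sum>y<v. if x \<in> d ! j \<and> y \<in> d ! j then 1 else 0) = (if x \<in> d ! j then 1 else 0) * k"
      by (simp add: sum.If_cases Int_absorb1 flip: Int_def)
  qed simp
  also have "\<dots> = r * k"
    using design_classD(4)[OF assms] by (simp add: concurrence_eq_sum flip: sum_distrib_right)
  finally show ?thesis .
qed

lemma information_matrix_carrier: "information_matrix v r k d \<in> carrier_mat v v"
  by (intro carrier_matI) (simp_all add: information_matrix_def incidence_matrix_def)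

lemma information_matrix_index:
  assumes "x < v" "y < v"
  shows "information_matrix v r k d $$ (x, y)
       = (if x = y then real r else 0) - real (concurrence d x y) / real k"
proof -
  have "(incidence_matrix v d * transpose_mat (incidence_matrix v d)) $$ (x, y)
      = (\<Sum>j<length d. if x \<in> d ! j \<and> y \<in> d ! j then 1 else 0)"
    using assms
    by (auto simp: incidence_matrix_def scalar_prod_def lessThan_atLeast0 intro!: sum.cong)
  also have "\<dots> = real (concurrence d x y)"
    by (simp add: concurrence_eq_sum of_nat_sum if_distrib cong: if_cong)
  finally show ?thesis
    using assms by (simp add: information_matrix_def incidence_matrix_def)
qed

text \<open>Passes from matrix vectors to plain functions, as used in
  \<open>zero_sum_eigenfunction_le\<close>.\<close>

lemma eigenvalue_iff_eigenfunction:
  assumes "M \<in> carrier_mat v v"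
  shows "eigenvalue M e \<longleftrightarrow>
    (\<exists>w. (\<exists>x<v. w x \<noteq> 0) \<and> (\<forall>x<v. (\<Sum>y<v. M $$ (x, y) * w y) = e * w x))"
    (is "_ \<longleftrightarrow> (\<exists>w. ?P w)")
proof
  assume "eigenvalue M e"
  then obtain u where u: "u \<in> carrier_vec v" "u \<noteq> 0\<^sub>v v" "M *\<^sub>v u = e \<cdot>\<^sub>v u"
    using assms by (auto simp: eigenvalue_def eigenvector_def)
  have "(\<Sum>y<v. M $$ (x, y) * u $ y) = e * u $ x" if "x < v" for x
  proof -
    have "(M *\<^sub>v u) $ x = (\<Sum>y<v. M $$ (x, y) * u $ y)"
      using that u(1) assms by (auto simp: scalar_prod_def lessThan_atLeast0 intro!: sum.cong)
    then show ?thesis using u that by simp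
  qed
  moreover have "\<exists>x<v. u $ x \<noteq> 0"
    using u(1,2) by (auto intro!: eq_vecI)
  ultimately show "\<exists>w. ?P w" by blast
next
  assume "\<exists>w. ?P w"
  then obtain w x where w: "x < v" "w x \<noteq> 0" "\<forall>x<v. (\<Sum>y<v. M $$ (x, y) * w y) = e * w x"
    by blast
  have "M *\<^sub>v vec v w = e \<cdot>\<^sub>v vec v w"
    using w(3) assms
    by (intro eq_vecI) (auto simp: scalar_prod_def lessThan_atLeast0 intro!: sum.cong)
  moreover have "vec v w \<noteq> 0\<^sub>v v"
    using w(1,2) by (metis index_vec index_zero_vec(1))
  ultimately show "eigenvalue M e"
    using assms unfolding eigenvalue_def eigenvector_def
    by (intro exI[of _ "vec v w"]) simp
qed

text \<open>Makes the \<open>Min\<close> in \<open>smallest_positive_eigenvalue\<close>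
  meaningful.\<close>

lemma finite_eigenvalues:
  fixes M :: "real mat"
  assumes "M \<in> carrier_mat v v"
  shows "finite {e. eigenvalue M e}"
proof -
  have "char_poly M \<noteq> 0" using degree_monic_char_poly[OF assms] by auto
  then show ?thesis
    unfolding eigenvalue_root_char_poly[OF assms] by (rule poly_roots_finite)
qed

text \<open>The quadratic form of N N^T.\<close>

definition concurrence_form :: "nat \<Rightarrow> block_design \<Rightarrow> (nat \<Rightarrow> real) \<Rightarrow> real" where
  "concurrence_form v d u = (\<Sum>x<v. \<Sum>y<v. real (concurrence d x y) * u x * u y)"

lemma information_row:
  assumes "x < v"
  shows "(\<Sum>y<v. information_matrix v r k d $$ (x, y) * w y)
    = real r * w x - (\<Sum>y<v. real (concurrence d x y) * w y) / real k"
proof -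
  have "(\<Sum>y<v. information_matrix v r k d $$ (x, y) * w y)
      = (\<Sum>y<v. (if x = y then real r * w y else 0) - real (concurrence d x y) * w y / real k)"
    using assms by (intro sum.cong) (auto simp: information_matrix_index algebra_simps)
  then show ?thesis
    using assms by (simp add: sum_subtractf sum_divide_distrib)
qed

lemma information_form:
  "(\<Sum>x<v. \<Sum>y<v. information_matrix v r k d $$ (x, y) * w x * w y)
    = real r * (\<Sum>x<v. (w x)\<^sup>2) - concurrence_form v d w / real k"
proof -
  have "(\<Sum>x<v. \<Sum>y<v. information_matrix v r k d $$ (x, y) * w x * w y)
      = (\<Sum>x<v. w x * (\<Sum>y<v. information_matrix v r k d $$ (x, y) * w y))"
    by (simp add: sum_distrib_left algebra_simps)
  also have "\<dots> = (\<Sum>x<v. real r * (w x)\<^sup>2 - (\<Sum>y<v. real (concurrence d x y) * w x * w y) / real k)"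
    by (intro sum.cong refl, subst information_row)
      (simp_all add: sum_distrib_left power2_eq_square algebra_simps)
  finally show ?thesis
    by (simp add: sum_subtractf sum_divide_distrib sum_distrib_left concurrence_form_def)
qed

lemma concurrence_row_sum_real:
  assumes "d \<in> design_class v b r k" "x < v"
  shows "(\<Sum>y<v. real (concurrence d x y)) = real r * real k"
  using concurrence_row_sum[OF assms] by (simp flip: of_nat_sum of_nat_mult)

text \<open>Laplacian identity from the constant row sums r k. For k > 0 the right-hand side is 2 k
  times the form of the information matrix, which is therefore positive semidefinite.\<close>

lemma concurrence_form_complementary:
  assumes "d \<in> design_class v b r k"
  shows "(\<Sum>x<v. \<Sum>y<v. real (concurrence d x y) * (w x - w y)\<^sup>2)
    = 2 * (real r * real k * (\<Sum>x<v. (w x)\<^sup>2) - concurrence_form v d w)"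
proof -
  have row: "(\<Sum>x<v. \<Sum>y<v. real (concurrence d x y) * f x) = real r * real k * (\<Sum>x<v. f x)" for f
    by (simp add: sum_distrib_right[symmetric] concurrence_row_sum_real[OF assms] sum_distrib_left)
  have col: "(\<Sum>x<v. \<Sum>y<v. real (concurrence d x y) * f y) = real r * real k * (\<Sum>x<v. f x)" for f
    by (subst sum.swap, subst row[symmetric]) (simp add: concurrence_sym)
  have "(\<Sum>x<v. \<Sum>y<v. real (concurrence d x y) * (w x - w y)\<^sup>2)
      = (\<Sum>x<v. \<Sum>y<v. real (concurrence d x y) * (w x)\<^sup>2 + real (concurrence d x y) * (w y)\<^sup>2
          - 2 * (real (concurrence d x y) * w x * w y))"
    by (simp add: power2_eq_square algebra_simps)
  also have "\<dots> = real r * real k * (\<Sum>x<v. (w x)\<^sup>2) + real r * real k * (\<Sum>x<v. (w x)\<^sup>2)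
      - 2 * concurrence_form v d w"
    by (simp only: sum.distrib sum_subtractf row col)
      (simp add: concurrence_form_def sum_distrib_left)
  finally show ?thesis by simp
qed

text \<open>Every term of the Laplacian sum vanishes, so w agrees on treatments sharing a block and
  hence along chains of blocks.\<close>

lemma connected_design_constant:
  assumes "d \<in> design_class v b r k" "connected_design v d"
    and "concurrence_form v d w = real r * real k * (\<Sum>x<v. (w x)\<^sup>2)" "x < v" "y < v"
  shows "w x = w y"
proof -
  have "(\<Sum>x<v. \<Sum>y<v. real (concurrence d x y) * (w x - w y)\<^sup>2) = 0"
    using concurrence_form_complementary[OF assms(1), of w] assms(3) by simp
  then have zero: "real (concurrence d x y) * (w x - w y)\<^sup>2 = 0" if "x < v" "y < v" for x y
    using that by (simp add: sum_nonneg_eq_0_iff sum_nonneg)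
  have step: "w p = w q" if pq: "(p, q) \<in> same_block d" for p q
  proof -
    obtain B where B: "B \<in> set d" "p \<in> B" "q \<in> B" using pq by (auto simp: same_block_def)
    then have "p < v" "q < v" using design_classD(2)[OF assms(1) B(1)] by auto
    moreover have "filter (\<lambda>B. p \<in> B \<and> q \<in> B) d \<noteq> []"
      using B by (auto simp: filter_empty_conv)
    ultimately show ?thesis using zero[of p q] by (simp add: concurrence_eq_filter)
  qed
  have "w p = w q" if "(p, q) \<in> (same_block d)\<^sup>*" for p q
    using that by (induction rule: rtrancl_induct) (auto dest: step)
  then show ?thesis using assms by (simp add: connected_design_def)
qed

lemma information_matrix_sum_zero:
  assumes "d \<in> design_class v b r k" "k > 0" "x < v"
  shows "(\<Sum>y<v. information_matrix v r k d $$ (x, y)) = 0"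
  using information_row[OF assms(3), of r k d "\<lambda>_. 1"] concurrence_row_sum_real[OF assms(1,3)] assms(2)
  by simp

lemma information_matrix_sym:
  "x < v \<Longrightarrow> y < v \<Longrightarrow> information_matrix v r k d $$ (x, y) = information_matrix v r k d $$ (y, x)"
  by (simp add: information_matrix_index concurrence_sym)

text \<open>The vector u bounds the least eigenvalue on the sum-zero space by r - s / k. It is
  positive because a kernel vector of a connected design is constant, hence zero on that
  space.\<close>

lemma positive_eigenvalue_le:
  assumes d: "d \<in> design_class v b r k" "k > 0" "connected_design v d"
    and u: "(\<Sum>x<v. u x) = 0" "\<exists>x<v. u x \<noteq> 0" "s * (\<Sum>x<v. (u x)\<^sup>2) \<le> concurrence_form v d u"
  obtains e where "eigenvalue (information_matrix v r k d) e" "0 < e" "e \<le> real r - s / real k"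
proof -
  have k: "real k > 0" using d by simp
  have "real r * (\<Sum>x<v. (u x)\<^sup>2) - concurrence_form v d u / real k
      \<le> (real r - s / real k) * (\<Sum>x<v. (u x)\<^sup>2)"
    using u(3) k by (simp add: field_simps)
  then obtain e w where e: "e \<le> real r - s / real k"
    and w: "(\<Sum>x<v. w x) = 0" "(\<Sum>x<v. (w x)\<^sup>2) = 1"
      "\<And>x. x < v \<Longrightarrow> (\<Sum>y<v. information_matrix v r k d $$ (x, y) * w y) = e * w x"
    using zero_sum_eigenfunction_le[of v "\<lambda>x y. information_matrix v r k d $$ (x, y)" u
        "real r - s / real k"] u(1,2) information_matrix_sym information_matrix_sum_zero[OF d(1,2)]
    by (auto simp: information_form)
  have nz: "\<exists>x<v. w x \<noteq> 0"
  proof (rule ccontr)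
    assume "\<not> ?thesis"
    then have "(\<Sum>x<v. (w x)\<^sup>2) = 0" by simp
    then show False using w(2) by simp
  qed
  have "(\<Sum>x<v. \<Sum>y<v. information_matrix v r k d $$ (x, y) * w x * w y) = (\<Sum>x<v. w x * (e * w x))"
    by (simp add: w(3)[symmetric] sum_distrib_left algebra_simps)
  also have "\<dots> = e * (\<Sum>x<v. (w x)\<^sup>2)"
    by (simp add: sum_distrib_left power2_eq_square algebra_simps)
  finally have "e = real r * (\<Sum>x<v. (w x)\<^sup>2) - concurrence_form v d w / real k"
    unfolding information_form using w(2) by simp
  then have ek: "e * real k = real r * real k * (\<Sum>x<v. (w x)\<^sup>2) - concurrence_form v d w"
    using k by (simp add: field_simps)
  have "0 \<le> (\<Sum>x<v. \<Sum>y<v. real (concurrence d x y) * (w x - w y)\<^sup>2)"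
    by (intro sum_nonneg) simp
  then have "e * real k \<ge> 0"
    unfolding concurrence_form_complementary[OF d(1)] ek by simp
  then have "e \<ge> 0" using k by (simp add: zero_le_mult_iff)
  moreover have "e \<noteq> 0"
  proof
    assume "e = 0"
    then have const: "w x = w y" if "x < v" "y < v" for x y
      using connected_design_constant[OF d(1,3)] ek that by simp
    obtain x where x: "x < v" "w x \<noteq> 0" using nz by blast
    have "(\<Sum>y<v. w y) = (\<Sum>y<v. w x)" using x(1) by (intro sum.cong refl const) auto
    then show False using w(1) x by simp
  qed
  moreover have "eigenvalue (information_matrix v r k d) e"
    unfolding eigenvalue_iff_eigenfunction[OF information_matrix_carrier] using nz w(3) by blast
  ultimately show ?thesis using that e by simp
qed

text \<open>Zero column sums make an eigenvector with nonzero eigenvalue orthogonal to the all-ones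
  vector, so \<open>form\<close> bounds its Rayleigh quotient.\<close>

lemma positive_eigenvalue_ge:
  assumes d: "d \<in> design_class v b r k" "k > 0"
    and form: "\<And>u. (\<Sum>x<v. u x) = 0 \<Longrightarrow> concurrence_form v d u \<le> s * (\<Sum>x<v. (u x)\<^sup>2)"
    and e: "eigenvalue (information_matrix v r k d) e" "0 < e"
  shows "real r - s / real k \<le> e"
proof -
  have k: "real k > 0" using d by simp
  obtain w where nz: "\<exists>x<v. w x \<noteq> 0"
    and w: "\<And>x. x < v \<Longrightarrow> (\<Sum>y<v. information_matrix v r k d $$ (x, y) * w y) = e * w x"
    using e(1) eigenvalue_iff_eigenfunction[OF information_matrix_carrier] by metis
  have "e * (\<Sum>x<v. w x) = (\<Sum>x<v. \<Sum>y<v. information_matrix v r k d $$ (x, y) * w y)"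
    by (simp add: w sum_distrib_left)
  also have "\<dots> = (\<Sum>y<v. (\<Sum>x<v. information_matrix v r k d $$ (y, x)) * w y)"
    by (subst sum.swap) (auto simp: sum_distrib_right information_matrix_sym intro!: sum.cong)
  also have "\<dots> = 0" by (simp add: information_matrix_sum_zero[OF d])
  finally have w0: "(\<Sum>x<v. w x) = 0" using e(2) by simp
  have pos: "(\<Sum>x<v. (w x)\<^sup>2) > 0" using nz by (auto intro!: sum_pos2)
  have "(\<Sum>x<v. \<Sum>y<v. information_matrix v r k d $$ (x, y) * w x * w y) = (\<Sum>x<v. w x * (e * w x))"
    by (simp add: w[symmetric] sum_distrib_left algebra_simps)
  also have "\<dots> = e * (\<Sum>x<v. (w x)\<^sup>2)"
    by (simp add: sum_distrib_left power2_eq_square algebra_simps)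
  finally have "e * (\<Sum>x<v. (w x)\<^sup>2) = real r * (\<Sum>x<v. (w x)\<^sup>2) - concurrence_form v d w / real k"
    by (simp add: information_form)
  also have "\<dots> \<ge> (real r - s / real k) * (\<Sum>x<v. (w x)\<^sup>2)"
    using form[OF w0] k by (simp add: field_simps)
  finally show ?thesis using pos by simp
qed

text \<open>The threshold s bounds the form of N N^T for d from above, and every competitor reaches
  it; r - s / k then separates their smallest positive eigenvalues.\<close>

lemma E_optimalI:
  assumes d: "d \<in> design_class v b r k" "k > 0" "connected_design v d"
    and upper: "\<And>u. (\<Sum>x<v. u x) = 0 \<Longrightarrow> concurrence_form v d u \<le> s * (\<Sum>x<v. (u x)\<^sup>2)"
    and lower: "\<And>d'. d' \<in> design_class v b r k \<Longrightarrow> \<exists>u. (\<Sum>x<v. u x) = 0 \<and> (\<exists>x<v. u x \<noteq> 0) \<and>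
        s * (\<Sum>x<v. (u x)\<^sup>2) \<le> concurrence_form v d' u"
  shows "E_optimal v b r k d"
  unfolding E_optimal_def
proof (intro conjI ballI impI)
  have fin: "finite {e. eigenvalue (information_matrix v r k d') e \<and> 0 < e}" for d'
    using finite_eigenvalues[OF information_matrix_carrier] by (rule rev_finite_subset) auto
  fix d' assume d': "d' \<in> design_class v b r k" "connected_design v d'"
  obtain u where "(\<Sum>x<v. u x) = 0" "\<exists>x<v. u x \<noteq> 0" "s * (\<Sum>x<v. (u x)\<^sup>2) \<le> concurrence_form v d' u"
    using lower[OF d'(1)] by blast
  then obtain e where e: "eigenvalue (information_matrix v r k d') e" "0 < e" "e \<le> real r - s / real k"
    by (rule positive_eigenvalue_le[OF d'(1) d(2) d'(2)])
  have "smallest_positive_eigenvalue (information_matrix v r k d') \<le> e"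
    unfolding smallest_positive_eigenvalue_def using e fin by (intro Min_le) auto
  also note e(3)
  also have "real r - s / real k \<le> smallest_positive_eigenvalue (information_matrix v r k d)"
    unfolding smallest_positive_eigenvalue_def
  proof (rule Min.boundedI[OF fin])
    \<comment> \<open>Applied to d itself, \<open>lower\<close> provides a positive eigenvalue, so
      \<open>Min\<close> is taken over a nonempty set.\<close>
    obtain u where "(\<Sum>x<v. u x) = 0" "\<exists>x<v. u x \<noteq> 0" "s * (\<Sum>x<v. (u x)\<^sup>2) \<le> concurrence_form v d u"
      using lower[OF d(1)] by blast
    from positive_eigenvalue_le[OF d this]
    show "{e. eigenvalue (information_matrix v r k d) e \<and> 0 < e} \<noteq> {}" by blast
  qed (use positive_eigenvalue_ge[OF d(1,2) upper] in auto)
  finally show "smallest_positive_eigenvalue (information_matrix v r k d')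
      \<le> smallest_positive_eigenvalue (information_matrix v r k d)" .
qed (use d in auto)

section \<open>Complementary designs and blocks of size 2\<close>

lemma concurrence_complement:
  assumes "x < v" "y < v"
  shows "concurrence (complement_design v d) x y + concurrence d x x + concurrence d y y
    = length d + concurrence d x y"
  \<comment> \<open>Inclusion-exclusion in each single block.\<close>
  using assms by (induction d) (auto simp: concurrence_eq_filter complement_design_def)

lemma complement_in_design_class:
  assumes "d \<in> design_class v b r k"
  shows "complement_design v d \<in> design_class v b (b - r) (v - k)"
proof -
  have "concurrence (complement_design v d) x x = b - r" if "x < v" for x
    using concurrence_complement[OF that that, of d] design_classD(1,4)[OF assms] that by simp
  moreover have "card ({..<v} - B) = v - k" if "B \<in> set d" for B
    using design_classD(2,3)[OF assms that] by (subst card_Diff_subset) (auto intro: finite_subset)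
  ultimately show ?thesis
    using design_classD(1)[OF assms]
    by (auto simp: design_class_def replication_eq_concurrence complement_design_def)
qed

text \<open>N N^T changes by (b - 2 r) J, whose form vanishes on sum-zero vectors.\<close>

lemma concurrence_form_complement:
  assumes "d \<in> design_class v b r k" "(\<Sum>x<v. u x) = 0"
  shows "concurrence_form v (complement_design v d) u = concurrence_form v d u"
proof -
  have c: "real (concurrence (complement_design v d) x y)
      = real (concurrence d x y) + (real b - 2 * real r)" if "x < v" "y < v" for x y
    using arg_cong[OF concurrence_complement[OF that, of d], of real] design_classD(1,4)[OF assms(1)] that
    by simp
  then have "concurrence_form v (complement_design v d) u
      = (\<Sum>x<v. \<Sum>y<v. real (concurrence d x y) * u x * u y + (real b - 2 * real r) * u x * u y)"
    unfolding concurrence_form_def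
    by (intro sum.cong refl) (simp only: c lessThan_iff distrib_right)
  also have "\<dots> = concurrence_form v d u"
    by (simp add: concurrence_form_def sum.distrib assms(2) flip: sum_distrib_left)
  finally show ?thesis .
qed

text \<open>For blocks of size 2, N N^T = (n - 1) I + A with A an (n - 1)-regular multigraph, so u^T
  A u >= u^T u yields the factor n.\<close>

lemma pair_design_form_ge:
  assumes "d \<in> design_class (2 * n) b (n - 1) 2" "n > 6"
  shows "\<exists>u. (\<Sum>x<2 * n. u x) = 0 \<and> (\<exists>x<2 * n. u x \<noteq> 0) \<and>
    real n * (\<Sum>x<2 * n. (u x)\<^sup>2) \<le> concurrence_form (2 * n) d u"
proof -
  define A where "A = (\<lambda>x y. if x = y then 0 else concurrence d x y)"
  have A: "concurrence d x y = A x y + (if x = y then n - 1 else 0)" if "x < 2 * n" for x y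
    using design_classD(4)[OF assms(1)] that by (simp add: A_def)
  have rows: "(\<Sum>y<2 * n. A x y) = n - 1" if "x < 2 * n" for x
    using concurrence_row_sum[OF assms(1) that] that by (simp add: A[OF that] sum.distrib)
  have sym: "A x y = A y x" and diag: "A x x = 0" for x y
    by (auto simp: A_def concurrence_sym)
  obtain u :: "nat \<Rightarrow> real" where u: "(\<Sum>x<2 * n. u x) = 0" "\<exists>x\<in>{..<2 * n}. u x \<noteq> 0"
    "(\<Sum>x<2 * n. (u x)\<^sup>2) \<le> (\<Sum>x<2 * n. \<Sum>y<2 * n. real (A x y) * u x * u y)"
    by (rule regular_multigraph_zero_sum_vector[where A = A, OF finite_lessThan card_lessThan assms(2) sym diag])
      (simp add: rows, blast)
  have "concurrence_form (2 * n) d u = (\<Sum>x<2 * n. \<Sum>y<2 * n. real (A x y) * u x * u y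
      + (if x = y then (real n - 1) * (u y)\<^sup>2 else 0))"
    unfolding concurrence_form_def using assms(2)
    by (intro sum.cong refl) (auto simp: A of_nat_diff power2_eq_square algebra_simps)
  also have "\<dots> = (\<Sum>x<2 * n. \<Sum>y<2 * n. real (A x y) * u x * u y) + (real n - 1) * (\<Sum>x<2 * n. (u x)\<^sup>2)"
    by (simp add: sum.distrib sum_distrib_left)
  finally show ?thesis using u by (intro exI[of _ u]) (auto simp: algebra_simps)
qed

section \<open>The crown design\<close>

lemma sum_lessThan_double:
  fixes f :: "nat \<Rightarrow> 'a :: comm_monoid_add"
  shows "(\<Sum>x<2 * n. f x) = (\<Sum>i<n. f i) + (\<Sum>i<n. f (n + i))"
proof -
  have split: "{..<2 * n} = {..<n} \<union> {n..<n + n}" by auto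
  have "(\<Sum>x<2 * n. f x) = (\<Sum>i<n. f i) + (\<Sum>i=n..<n + n. f i)"
    unfolding split by (rule sum.union_disjoint) auto
  also have "(\<Sum>i=n..<n + n. f i) = (\<Sum>i<n. f (n + i))"
    using sum.shift_bounds_nat_ivl[of f 0 n n] by (simp add: lessThan_atLeast0 add.commute)
  finally show ?thesis .
qed

text \<open>Treatment n + i lies below i in the array, so the columns are the removed
  matching.\<close>

definition crown_blocks :: "nat \<Rightarrow> nat set set" where
  "crown_blocks n = (\<lambda>(i, j). {i, n + j}) ` (SIGMA i:{..<n}. {..<n} - {i})"

lemma crown_blocks_iff:
  "B \<in> crown_blocks n \<longleftrightarrow> (\<exists>i<n. \<exists>j<n. i \<noteq> j \<and> B = {i, n + j})"
  by (auto simp: crown_blocks_def image_iff)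

lemma finite_crown_blocks: "finite (crown_blocks n)"
  by (simp add: crown_blocks_def)

lemma card_crown_blocks: "card (crown_blocks n) = n * (n - 1)"
proof -
  have "inj_on (\<lambda>(i, j). {i, n + j}) (SIGMA i:{..<n}. {..<n} - {i})"
    by (auto simp: inj_on_def doubleton_eq_iff)
  then show ?thesis
    by (simp add: crown_blocks_def card_image)
qed

text \<open>Any ordering of the edges will do; \<open>distinct\<close> turns concurrences into
  cardinalities of sets of edges.\<close>

locale crown =
  fixes n :: nat and d :: block_design
  assumes n_gt: "n > 6" and dist: "distinct d" and set_d: "set d = crown_blocks n"
begin

lemma concurrence_card: "concurrence d x y = card {B \<in> crown_blocks n. x \<in> B \<and> y \<in> B}"
  using distinct_card[OF distinct_filter[OF dist], of "\<lambda>B. x \<in> B \<and> y \<in> B"]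
  by (simp add: concurrence_eq_filter set_d)

lemma concurrence_same_half:
  assumes "i < n" "j < n" "i \<noteq> j"
  shows "concurrence d i j = 0" "concurrence d (n + i) (n + j) = 0"
  using assms by (auto simp: concurrence_card crown_blocks_iff card_eq_0_iff)

lemma concurrence_halves:
  assumes "i < n" "j < n"
  shows "concurrence d i (n + j) = (if i = j then 0 else 1)"
proof -
  have "{B \<in> crown_blocks n. i \<in> B \<and> n + j \<in> B} = (if i = j then {} else {{i, n + j}})"
    using assms by (auto simp: crown_blocks_iff)
  then show ?thesis by (simp add: concurrence_card)
qed

lemma concurrence_self:
  assumes "i < n"
  shows "concurrence d i i = n - 1" "concurrence d (n + i) (n + i) = n - 1"
proof -
  have "{B \<in> crown_blocks n. i \<in> B \<and> i \<in> B} = (\<lambda>j. {i, n + j}) ` ({..<n} - {i})"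
    using assms by (auto simp: crown_blocks_iff image_iff)
  moreover have "inj_on (\<lambda>j. {i, n + j}) ({..<n} - {i})"
    using assms by (auto simp: inj_on_def doubleton_eq_iff)
  ultimately show "concurrence d i i = n - 1"
    using assms unfolding concurrence_card by (simp add: card_image)
  have "{B \<in> crown_blocks n. n + i \<in> B \<and> n + i \<in> B} = (\<lambda>j. {j, n + i}) ` ({..<n} - {i})"
    using assms by (auto simp: crown_blocks_iff image_iff)
  moreover have "inj_on (\<lambda>j. {j, n + i}) ({..<n} - {i})"
    using assms by (auto simp: inj_on_def doubleton_eq_iff)
  ultimately show "concurrence d (n + i) (n + i) = n - 1"
    using assms unfolding concurrence_card by (simp add: card_image)
qed

lemma half_cases:
  assumes "x < 2 * n"
  obtains i where "i < n" "x = i" | i where "i < n" "x = n + i"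
proof (cases "x < n")
  case False
  then show ?thesis using assms that(2)[of "x - n"] by simp
qed (use that(1) in simp)

lemma in_design_class: "d \<in> design_class (2 * n) (n * (n - 1)) (n - 1) 2"
proof -
  have "length d = n * (n - 1)"
    using distinct_card[OF dist] by (simp add: set_d card_crown_blocks)
  moreover have "B \<subseteq> {..<2 * n} \<and> card B = 2" if "B \<in> set d" for B
    using that by (auto simp: set_d crown_blocks_iff)
  moreover have "concurrence d x x = n - 1" if "x < 2 * n" for x
    using that by (rule half_cases) (auto simp: concurrence_self)
  ultimately show ?thesis
    by (simp add: design_class_def replication_eq_concurrence)
qed

lemma same_block_halves:
  assumes "i < n" "j < n" "i \<noteq> j"
  shows "(i, n + j) \<in> same_block d" "(n + j, i) \<in> same_block d"
proof -
  have "{i, n + j} \<in> set d"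
    unfolding set_d crown_blocks_iff using assms by blast
  then show "(i, n + j) \<in> same_block d" "(n + j, i) \<in> same_block d"
    unfolding same_block_def by blast+
qed

lemma connected: "connected_design (2 * n) d"
proof -
  have left: "(i, j) \<in> (same_block d)\<^sup>*" if ij: "i < n" "j < n" for i j
  proof -
    \<comment> \<open>An index k other than i and j gives the path i, n + k, j.\<close>
    have "card {i, j} < card {..<n}" using n_gt card_insert_le_m1[of 2 "{j}" i] by simp
    then have "\<not> {..<n} \<subseteq> {i, j}" by (meson card_mono finite.intros not_le)
    then obtain k where "k < n" "k \<noteq> i" "k \<noteq> j" by auto
    then have "(i, n + k) \<in> same_block d" "(n + k, j) \<in> same_block d"
      using same_block_halves[of _ k] ij by auto
    then show ?thesis by (rule rtrancl.rtrancl_into_rtrancl[OF r_into_rtrancl])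
  qed
  have other: "\<exists>k<n. k \<noteq> i" for i
    using n_gt by (intro exI[of _ "if i = 0 then 1 else 0"]) auto
  have to: "\<exists>i<n. (x, i) \<in> (same_block d)\<^sup>* \<and> (i, x) \<in> (same_block d)\<^sup>*" if "x < 2 * n" for x
    using that
  proof (cases rule: half_cases)
    case (2 i)
    obtain k where "k < n" "k \<noteq> i" using other by blast
    then show ?thesis using 2 same_block_halves[of k i] by blast
  qed blast
  show ?thesis
    unfolding connected_design_def using to left by (meson rtrancl_trans)
qed

text \<open>The half sums are a and -a, and the difference of the two sides is the sum of the
  squares (u_i + u_{n+i})^2 plus 2 a^2.\<close>

lemma form_le:
  assumes "(\<Sum>x<2 * n. u x) = 0"
  shows "concurrence_form (2 * n) d u \<le> real n * (\<Sum>x<2 * n. (u x)\<^sup>2)"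
proof -
  define a where "a = (\<Sum>i<n. u i)"
  define Q where "Q = (\<Sum>i<n. (u i)\<^sup>2) + (\<Sum>i<n. (u (n + i))\<^sup>2)"
  define P where "P = (\<Sum>i<n. u i * u (n + i))"
  have b: "(\<Sum>i<n. u (n + i)) = - a"
    using assms by (simp add: sum_lessThan_double a_def)
  have n1: "real (n - 1) = real n - 1" using n_gt by simp
  have same: "(\<Sum>i<n. \<Sum>j<n. real (concurrence d i j) * u i * u j) = (real n - 1) * (\<Sum>i<n. (u i)\<^sup>2)"
    "(\<Sum>i<n. \<Sum>j<n. real (concurrence d (n + i) (n + j)) * u (n + i) * u (n + j))
      = (real n - 1) * (\<Sum>i<n. (u (n + i))\<^sup>2)"
  proof -
    have "(\<Sum>i<n. \<Sum>j<n. real (concurrence d i j) * u i * u j)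
        = (\<Sum>i<n. \<Sum>j<n. if i = j then (real n - 1) * (u j)\<^sup>2 else 0)"
      by (intro sum.cong refl) (auto simp: concurrence_same_half concurrence_self n1 power2_eq_square)
    then show "(\<Sum>i<n. \<Sum>j<n. real (concurrence d i j) * u i * u j) = (real n - 1) * (\<Sum>i<n. (u i)\<^sup>2)"
      by (simp add: sum_distrib_left)
    have "(\<Sum>i<n. \<Sum>j<n. real (concurrence d (n + i) (n + j)) * u (n + i) * u (n + j))
        = (\<Sum>i<n. \<Sum>j<n. if i = j then (real n - 1) * (u (n + j))\<^sup>2 else 0)"
      by (intro sum.cong refl) (auto simp: concurrence_same_half concurrence_self n1 power2_eq_square)
    then show "(\<Sum>i<n. \<Sum>j<n. real (concurrence d (n + i) (n + j)) * u (n + i) * u (n + j))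
      = (real n - 1) * (\<Sum>i<n. (u (n + i))\<^sup>2)"
      by (simp add: sum_distrib_left)
  qed
  have cross: "(\<Sum>i<n. \<Sum>j<n. real (concurrence d i (n + j)) * u i * u (n + j)) = a * (- a) - P"
  proof -
    have "(\<Sum>i<n. \<Sum>j<n. real (concurrence d i (n + j)) * u i * u (n + j))
        = (\<Sum>i<n. \<Sum>j<n. u i * u (n + j) - (if i = j then u j * u (n + j) else 0))"
      by (intro sum.cong refl) (auto simp: concurrence_halves)
    also have "\<dots> = (\<Sum>i<n. u i) * (\<Sum>j<n. u (n + j)) - P"
      by (simp add: sum_subtractf sum_product P_def)
    finally show ?thesis by (simp add: b a_def)
  qed
  have cross': "(\<Sum>i<n. \<Sum>j<n. real (concurrence d (n + i) j) * u (n + i) * u j) = a * (- a) - P"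
    unfolding cross[symmetric] by (subst sum.swap) (simp add: concurrence_sym mult_ac)
  have "concurrence_form (2 * n) d u = (real n - 1) * Q + 2 * (a * (- a) - P)"
    unfolding concurrence_form_def sum_lessThan_double sum.distrib same cross cross' Q_def
    by (simp add: algebra_simps)
  moreover have "Q + 2 * P = (\<Sum>i<n. (u i + u (n + i))\<^sup>2)"
    by (simp add: Q_def P_def power2_sum sum.distrib sum_distrib_left mult.assoc)
  moreover have "\<dots> \<ge> 0" by (intro sum_nonneg) simp
  moreover have "real n * Q - ((real n - 1) * Q + 2 * (a * (- a) - P)) = (Q + 2 * P) + 2 * (a * a)"
    by (simp add: algebra_simps)
  moreover have "a * a \<ge> 0" by simp
  ultimately have "concurrence_form (2 * n) d u \<le> real n * Q" by linarith
  then show ?thesis by (simp add: sum_lessThan_double Q_def)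
qed

lemma concurrence_array:
  assumes "x < 2 * n" "y < 2 * n" "x \<noteq> y"
  shows "concurrence d x y = (if x div n = y div n then 0 else if x mod n = y mod n then 0 else 1)"
  using assms(1)
proof (cases rule: half_cases)
  case x: (1 i)
  show ?thesis using assms(2)
    by (cases rule: half_cases) (use x assms(3) in \<open>auto simp: concurrence_same_half concurrence_halves\<close>)
next
  case x: (2 i)
  show ?thesis using assms(2)
    by (cases rule: half_cases)
      (use x assms(3) in \<open>auto simp: concurrence_same_half concurrence_halves concurrence_sym[of d "n + i"]\<close>)
qed

lemma bij_array: "bij_betw (\<lambda>x. (x div n, x mod n)) {..<2 * n} ({..<2} \<times> {..<n})"
proof (rule bij_betw_byWitness[where f' = "\<lambda>(i, j). i * n + j"])
  have "i * n + j < 2 * n" if "i < 2" "j < n" for i j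
    using that by (cases i) auto
  then show "(\<lambda>(i, j). i * n + j) ` ({..<2} \<times> {..<n}) \<subseteq> {..<2 * n}" by auto
qed (use n_gt in \<open>auto simp: less_mult_imp_div_less\<close>)

lemma balanced_crown: "balanced_type1_RD (2 * n) (n * (n - 1)) (n - 1) 2 0 0 1 2 n d"
  unfolding balanced_type1_RD_def rectangular_design_def
proof (intro conjI exI allI impI)
  show "bij_betw (\<lambda>x. (x div n, x mod n)) {..<2 * n} ({..<2} \<times> {..<n})" by (rule bij_array)
qed (use in_design_class in \<open>simp_all add: concurrence_array\<close>)

lemma E_optimal_crown: "E_optimal (2 * n) (n * (n - 1)) (n - 1) 2 d"
  by (rule E_optimalI[OF in_design_class _ connected form_le pair_design_form_ge[OF _ n_gt]]) simp_all

section \<open>The complementary series\<close>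

abbreviation "d' \<equiv> complement_design (2 * n) d"

text \<open>The first two equations give the parameters of the complement; the last two return a
  competitor to blocks of size 2.\<close>

lemma blocks_minus: "n * (n - 1) - (n - 1) = (n - 1)\<^sup>2" "2 * n - 2 = 2 * (n - 1)"
  "n * (n - 1) - (n - 1)\<^sup>2 = n - 1" "2 * n - 2 * (n - 1) = 2"
proof -
  obtain m where "n = Suc m" using n_gt by (cases n) auto
  then show "n * (n - 1) - (n - 1) = (n - 1)\<^sup>2" "2 * n - 2 = 2 * (n - 1)"
    "n * (n - 1) - (n - 1)\<^sup>2 = n - 1" "2 * n - 2 * (n - 1) = 2"
    by (auto simp: power2_eq_square)
qed

lemma complement_class: "d' \<in> design_class (2 * n) (n * (n - 1)) ((n - 1)\<^sup>2) (2 * (n - 1))"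
  using complement_in_design_class[OF in_design_class] by (simp only: blocks_minus)

text \<open>The shift is b - 2 r = n (n - 1) - 2 (n - 1).\<close>

lemma concurrence_complement_array:
  assumes "x < 2 * n" "y < 2 * n" "x \<noteq> y"
  shows "concurrence d' x y = (n - 1) * (n - 2) + concurrence d x y"
proof -
  have "concurrence d' x y + (n - 1) + (n - 1) = n * (n - 1) + concurrence d x y"
    using concurrence_complement[OF assms(1,2), of d] design_classD(1,4)[OF in_design_class] assms
    by simp
  moreover have "n = Suc (Suc (n - 2))" using n_gt by simp
  then obtain m where "n = Suc (Suc m)" by blast
  ultimately show ?thesis by simp
qed

lemma complement_balanced_crown: "balanced_type1_RD (2 * n) (n * (n - 1)) ((n - 1)\<^sup>2) (2 * (n - 1))
    ((n - 1) * (n - 2)) ((n - 1) * (n - 2)) ((n - 1) * (n - 2) + 1) 2 n d'"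
  unfolding balanced_type1_RD_def rectangular_design_def
proof (intro conjI exI allI impI)
  show "bij_betw (\<lambda>x. (x div n, x mod n)) {..<2 * n} ({..<2} \<times> {..<n})" by (rule bij_array)
qed (use complement_class in \<open>simp_all add: concurrence_complement_array concurrence_array\<close>)

lemma complement_connected: "connected_design (2 * n) d'"
  unfolding connected_design_def
proof (intro allI impI)
  fix x y assume xy: "x < 2 * n" "y < 2 * n"
  show "(x, y) \<in> (same_block d')\<^sup>*"
  proof (cases "x = y")
    case False
    then have "concurrence d' x y > 0"
      using n_gt by (simp add: concurrence_complement_array[OF xy])
    then obtain B where "B \<in> set d'" "x \<in> B" "y \<in> B"
      by (auto simp: concurrence_eq_filter filter_empty_conv)
    then show ?thesis by (auto simp: same_block_def)
  qed simp
qed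

lemma complement_E_optimal_crown: "E_optimal (2 * n) (n * (n - 1)) ((n - 1)\<^sup>2) (2 * (n - 1)) d'"
proof (rule E_optimalI[where s = "real n", OF complement_class _ complement_connected])
  show "concurrence_form (2 * n) d' u \<le> real n * (\<Sum>x<2 * n. (u x)\<^sup>2)" if "(\<Sum>x<2 * n. u x) = 0" for u
    using form_le[OF that] concurrence_form_complement[OF in_design_class that] by simp
  fix e assume e: "e \<in> design_class (2 * n) (n * (n - 1)) ((n - 1)\<^sup>2) (2 * (n - 1))"
  \<comment> \<open>The complement of a competitor has blocks of size 2 and the same form on
    sum-zero vectors, so the threshold n carries over.\<close>
  have "complement_design (2 * n) e \<in> design_class (2 * n) (n * (n - 1)) (n - 1) 2"
    using complement_in_design_class[OF e] by (simp only: blocks_minus)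
  from pair_design_form_ge[OF this n_gt]
  show "\<exists>u. (\<Sum>x<2 * n. u x) = 0 \<and> (\<exists>x<2 * n. u x \<noteq> 0) \<and>
      real n * (\<Sum>x<2 * n. (u x)\<^sup>2) \<le> concurrence_form (2 * n) e u"
    using concurrence_form_complement[OF e] by auto
qed (use n_gt in simp)

end

theorem theorem11:
  fixes n :: nat
  assumes "n > 6"
  shows "\<exists>d.
    (balanced_type1_RD (2 * n) (n * (n - 1)) (n - 1) 2 0 0 1 2 n d \<and>
     E_optimal (2 * n) (n * (n - 1)) (n - 1) 2 d) \<and>
    (balanced_type1_RD (2 * n) (n * (n - 1)) ((n - 1)\<^sup>2) (2 * (n - 1))
       ((n - 1) * (n - 2)) ((n - 1) * (n - 2)) ((n - 1) * (n - 2) + 1) 2 n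
       (complement_design (2 * n) d) \<and>
     E_optimal (2 * n) (n * (n - 1)) ((n - 1)\<^sup>2) (2 * (n - 1))
       (complement_design (2 * n) d))"
proof -
  obtain d where "set d = crown_blocks n" "distinct d"
    using finite_distinct_list[OF finite_crown_blocks] by blast
  then interpret crown n d
    using assms by unfold_locales
  show ?thesis
    using balanced_crown E_optimal_crown complement_balanced_crown complement_E_optimal_crown by blast
qed

end
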